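(* Let $n\in\mathbb{N}$ and let $\mathcal{L}$ be a finite set of rectangular polyominoes. If $\mathcal{L}$ is $n$-representable, then $\mathcal{L}$ is strongly $n$-Noetherian.
   Context: A polyomino is a region of $\mathbb{R}^2$ made of unit squares joined along coincident edges, considered up to translation; $p_{a\times b}$ is the rectangular polyomino of height $a$ and width $b$. $R_{n\times m}$ denotes the rectangular region of height $n$ (rows numbered $1,\dots,n$) and width $m$. A tiling of $R_{n\times m}$ by a multiset $T$ of polyominoes is a placement of translates of all elements of $T$ in $R_{n\times m}$ covering every point, with no two different elements having two-dimensional overlap; a tiling by elements of $\mathcal{L}$ is a tiling by a multiset with elements drawn from $\mathcal{L}$. A rearrangement of a tiling by $T$ is any tiling of $R_{n\times m}$ by the same multiset $T$. A tiling of $R_{n\times m}$ admits a subtiling if it has a rearrangement which is the side-by-side juxtaposition of a tiling of $R_{n\times m'}$ and a tiling of $R_{n\times m''}$ with $m=m'+m''$, $m',m''\neq 0$. $\beta_n(\mathcal{L})$ is the smallest natural number such that every tiling of $R_{n\times m}$ by elements of $\mathcal{L}$ with $m>\beta_n(\mathcal{L})$ admits a subtiling, and $\infty$ if no such number exists. $\mathcal{L}$ is strongly $n$-Noetherian if $\beta_n(\mathcal{L})<\infty$. Let $I(n)$ be the set of non-empty contiguous intervals of $\{1,\dots,n\}$. $\mathcal{L}$ is $n$-representable if for every $m$ and every finite multiset $\mathcal{P}$ of pairs $(p_{a\times b},\iota)$ with $p_{a\times b}\in\mathcal{L}$ and $\iota\in I(n)$ having exactly $a$ elements, whenever $$\sum_{(p_{a\times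 b},\iota)\in\mathcal{P}}ab=nm\quad\text{and}\quad\sum_{(p_{a\times b},\iota)\in\mathcal{P},\ i\in\iota}b=m\ \text{ for all }1\le i\le n,$$ there is a tiling of $R_{n\times m}$ by the polyominoes of $\mathcal{P}$ in which each $(p_{a\times b},\iota)$ is placed so that it occupies exactly the rows in $\iota$. *)

theory Defs
  imports "HOL-Analysis.Analysis" "HOL-Library.Multiset" "HOL-Library.Extended_Nat"
begin

type_synonym region = "(real \<times> real) set"

text \<open>
  A shape considered up to translation is the class of all its translates, by arbitrary real
  vectors.
\<close>

type_synonym shape = "region set"

definition shift :: "real \<times> real \<Rightarrow> region \<Rightarrow> region" where
  "shift v A = (+) v ` A"

definition shape_of :: "region \<Rightarrow> shape" where
  "shape_of A = range (\<lambda>v. shift v A)"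

text \<open>
  The first coordinate runs along the width, the second along the height: row \<open>i\<close> is the
  strip with second coordinate in \<open>[i - 1, i]\<close>.
\<close>

definition cell :: "nat \<Rightarrow> nat \<Rightarrow> region" where
  "cell i j = {real j - 1..real j} \<times> {real i - 1..real i}"

text \<open>
  As a union of unit squares, \<open>Rect n m\<close> is empty (not a segment) when \<open>n = 0\<close> or \<open>m = 0\<close>.
\<close>

definition Rect :: "nat \<Rightarrow> nat \<Rightarrow> region" where
  "Rect n m = (\<Union>i\<in>{1..n}. \<Union>j\<in>{1..m}. cell i j)"

definition rect_polyomino :: "nat \<Rightarrow> nat \<Rightarrow> shape" where
  "rect_polyomino a b = shape_of (Rect a b)"

definition rect_polyominoes :: "shape set" where
  "rect_polyominoes = {rect_polyomino a b | a b. 1 \<le> a \<and> 1 \<le> b}"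

text \<open>
  A tiling is recorded as the set \<open>Q\<close> of its placed pieces. A set suffices: two pieces
  of nonempty interior in the same position would overlap.
\<close>

definition is_tiling :: "region \<Rightarrow> shape multiset \<Rightarrow> region set \<Rightarrow> bool" where
  "is_tiling R T Q \<longleftrightarrow>
     finite Q \<and> image_mset shape_of (mset_set Q) = T \<and> \<Union>Q = R \<and>
     (\<forall>A\<in>Q. \<forall>B\<in>Q. A \<noteq> B \<longrightarrow> interior (A \<inter> B) = {})"

definition tiling_by_elements :: "region \<Rightarrow> shape set \<Rightarrow> region set \<Rightarrow> bool" where
  "tiling_by_elements R L Q \<longleftrightarrow> (\<exists>T. set_mset T \<subseteq> L \<and> is_tiling R T Q)"

definition rearrangement :: "region \<Rightarrow> region set \<Rightarrow> region set \<Rightarrow> bool" where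
  "rearrangement R Q Q' \<longleftrightarrow> (\<exists>T. is_tiling R T Q \<and> is_tiling R T Q')"

definition admits_subtiling :: "nat \<Rightarrow> nat \<Rightarrow> region set \<Rightarrow> bool" where
  "admits_subtiling n m Q \<longleftrightarrow>
     (\<exists>Q' m' m'' T' T'' Q1 Q2.
        rearrangement (Rect n m) Q Q' \<and> m = m' + m'' \<and> m' \<noteq> 0 \<and> m'' \<noteq> 0 \<and>
        is_tiling (Rect n m') T' Q1 \<and> is_tiling (Rect n m'') T'' Q2 \<and>
        Q' = Q1 \<union> shift (real m', 0) ` Q2)"

definition subtiling_bound :: "nat \<Rightarrow> shape set \<Rightarrow> nat \<Rightarrow> bool" where
  "subtiling_bound n L N \<longleftrightarrow>
     (\<forall>m Q. m > N \<and> tiling_by_elements (Rect n m) L Q \<longrightarrow> admits_subtiling n m Q)"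

definition beta :: "nat \<Rightarrow> shape set \<Rightarrow> enat" where
  "beta n L =
     (if \<exists>N. subtiling_bound n L N then enat (LEAST N. subtiling_bound n L N) else \<infinity>)"

definition strongly_Noetherian :: "nat \<Rightarrow> shape set \<Rightarrow> bool" where
  "strongly_Noetherian n L \<longleftrightarrow> beta n L < \<infinity>"

definition intervals :: "nat \<Rightarrow> nat set set" where
  "intervals n = {{i..j} | i j. 1 \<le> i \<and> i \<le> j \<and> j \<le> n}"

definition occupies_rows :: "region \<Rightarrow> nat set \<Rightarrow> bool" where
  "occupies_rows A \<iota> \<longleftrightarrow> snd ` A = (\<Union>i\<in>\<iota>. {real i - 1..real i})"

text \<open>
  A pair consisting of the \<open>a \<times> b\<close> rectangular polyomino and an interval \<open>\<iota>\<close> is encoded as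
  \<open>((a, b), \<iota>)\<close>. The relator \<^const>\<open>rel_mset\<close> matches the placed pieces bijectively with the
  elements of \<open>P\<close>.
\<close>

definition representable :: "nat \<Rightarrow> shape set \<Rightarrow> bool" where
  "representable n L \<longleftrightarrow>
     (\<forall>(m :: nat) (P :: ((nat \<times> nat) \<times> nat set) multiset).
        (\<forall>((a, b), \<iota>) \<in># P. 1 \<le> a \<and> 1 \<le> b \<and> rect_polyomino a b \<in> L \<and>
                            \<iota> \<in> intervals n \<and> card \<iota> = a) \<and>
        (\<Sum>((a, b), \<iota>) \<in># P. a * b) = n * m \<and>
        (\<forall>i\<in>{1..n}. (\<Sum>((a, b), \<iota>) \<in># {#((a, b), \<iota>) \<in># P. i \<in> \<iota>#}. b) = m) \<longrightarrow>
        (\<exists>Q. is_tiling (Rect n m) {#rect_polyomino a b. ((a, b), \<iota>) \<in># P#} Q \<and>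
             rel_mset (\<lambda>A ((a, b), \<iota>). shape_of A = rect_polyomino a b \<and> occupies_rows A \<iota>)
               (mset_set Q) P))"

end

theory Submission
  imports Defs
begin

text \<open>
  Record a tiling of width \<open>m\<close> by the multiset of its pieces together with the rows they occupy.
  The conditions in the definition of representability are linear in this multiset and \<open>m\<close>, so
  they pass to differences. If tilings of unbounded width admitted no subtiling, Dickson's lemma
  would yield two of them, of widths \<open>m < m'\<close>, with the multiset of the narrower contained in that
  of the wider. The difference is then realised by a tiling of width \<open>m' - m\<close>; placing it next to
  the narrower tiling rearranges the wider one into two parts, a contradiction.
\<close>

section \<open>Rectangles, translates and shapes\<close>

lemma Rect_eq_Times:
  assumes "1 \<le> a" "1 \<le> b"
  shows "Rect a b = {0..real b} \<times> {0..real a}"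
proof -
  have *: "(\<Union>j\<in>{1..k}. {real j - 1..real j}) = {0..real k}" if "1 \<le> k" for k :: nat
    using that
  proof (induction k rule: nat_induct_at_least)
    case base
    then show ?case by simp
  next
    case (Suc k)
    have "{1..Suc k} = insert (Suc k) {1..k}" by auto
    then have "(\<Union>j\<in>{1..Suc k}. {real j - 1..real j}) = {real k..real (Suc k)} \<union> {0..real k}"
      using Suc.IH by simp
    then show ?case by auto
  qed
  have "Rect a b = (\<Union>j\<in>{1..b}. {real j - 1..real j}) \<times> (\<Union>i\<in>{1..a}. {real i - 1..real i})"
    unfolding Rect_def cell_def by blast
  then show ?thesis
    using assms by (simp only: *)
qed

lemma Rect_empty [simp]: "Rect 0 m = {}" "Rect n 0 = {}"
  by (simp_all add: Rect_def)

lemma Rect_subset: "Rect n m \<subseteq> {0..real m} \<times> {0..real n}"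
  by (cases "n = 0 \<or> m = 0") (auto simp: Rect_eq_Times Suc_le_eq)

lemma shift_Times:
  "shift (x, y) ({p..q} \<times> {r..s}) = {x + p..x + q} \<times> {y + r..y + s}" (is "?L = ?R")
proof
  show "?R \<subseteq> ?L"
  proof
    fix z assume z: "z \<in> ?R"
    have "z = (x, y) + (fst z - x, snd z - y)" by (simp add: prod_eq_iff)
    moreover have "(fst z - x, snd z - y) \<in> {p..q} \<times> {r..s}" using z by auto
    ultimately show "z \<in> ?L" unfolding shift_def by blast
  qed
qed (auto simp: shift_def)

lemma shift_shift: "shift v (shift w A) = shift (v + w) A"
  by (simp add: shift_def image_image add.assoc)

lemma shift_0 [simp]: "shift 0 A = A"
  by (simp add: shift_def)

lemma mem_shape_of: "A \<in> shape_of A"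
  unfolding shape_of_def by (metis rangeI shift_0)

lemma shape_of_shift [simp]: "shape_of (shift v A) = shape_of A"
proof
  show "shape_of (shift v A) \<subseteq> shape_of A"
    unfolding shape_of_def shift_shift by blast
  have "shift w A = shift (w - v) (shift v A)" for w by (simp add: shift_shift)
  then show "shape_of A \<subseteq> shape_of (shift v A)"
    unfolding shape_of_def by blast
qed

text \<open>Shapes are classes under translation only, so a piece with the shape of a rectangle is a
  closed axis-parallel box, possibly at a non-integer position.\<close>

lemma shape_of_eq_rect_polyominoD:
  assumes "shape_of A = rect_polyomino a b" "1 \<le> a" "1 \<le> b"
  obtains x y where "A = {x..x + real b} \<times> {y..y + real a}"
proof -
  have "A \<in> shape_of (Rect a b)"
    using assms(1) mem_shape_of[of A] by (simp add: rect_polyomino_def)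
  then obtain x y where "A = shift (x, y) (Rect a b)"
    by (auto simp: shape_of_def)
  then show thesis
    using that assms by (simp add: Rect_eq_Times shift_Times)
qed

text \<open>Equal nonempty boxes have equal side intervals, hence equal side lengths. This turns
  finiteness of a set of shapes into finiteness of the set of their dimensions.\<close>

lemma rect_polyomino_inject:
  assumes "rect_polyomino a b = rect_polyomino c d" "1 \<le> a" "1 \<le> b" "1 \<le> c" "1 \<le> d"
  shows "a = c \<and> b = d"
proof -
  have "shape_of (Rect a b) = rect_polyomino c d"
    using assms(1) by (simp add: rect_polyomino_def)
  then obtain x y where "Rect a b = {x..x + real d} \<times> {y..y + real c}"
    using assms(4,5) by (rule shape_of_eq_rect_polyominoD)
  then have "{0..real b} \<times> {0..real a} = {x..x + real d} \<times> {y..y + real c}"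
    using assms by (simp add: Rect_eq_Times)
  then show ?thesis
    by (auto simp: times_eq_iff)
qed

lemma Rect_add: "Rect n (m' + m'') = Rect n m' \<union> shift (real m', 0) (Rect n m'')"
\<comment> \<open>A rectangle with a zero side is empty rather than a degenerate box, so these cases
  are separate.\<close>
proof (cases "n = 0 \<or> m' = 0 \<or> m'' = 0")
  case True
  then show ?thesis
    by (auto simp: shift_def simp flip: zero_prod_def)
next
  case False
  then show ?thesis
    by (auto simp: Rect_eq_Times shift_Times)
qed

section \<open>Juxtaposition of tilings\<close>

lemma is_tiling_subset: "is_tiling R T Q \<Longrightarrow> A \<in> Q \<Longrightarrow> A \<subseteq> R"
  by (auto simp: is_tiling_def)

lemma is_tiling_interior:
  "is_tiling R T Q \<Longrightarrow> A \<in> Q \<Longrightarrow> B \<in> Q \<Longrightarrow> A \<noteq> B \<Longrightarrow> interior (A \<inter> B) = {}"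
  unfolding is_tiling_def by (elim conjE) (drule (1) bspec, drule (1) bspec, erule (1) mp)

lemma is_tiling_shape_of: "is_tiling R T Q \<Longrightarrow> A \<in> Q \<Longrightarrow> shape_of A \<in># T"
  by (auto simp: is_tiling_def)

lemma interior_shift: "interior (shift v A) = shift v (interior A)"
  unfolding shift_def by (rule interior_translation)

lemma interior_vertical_line: "interior ({c :: real} \<times> (UNIV :: real set)) = {}"
  by (simp add: interior_Times)

text \<open>Pieces from the two sides meet at most in the vertical line at \<open>m'\<close>, which
  has empty interior. The hypothesis on \<open>T'\<close> gives every piece of \<open>Q1\<close>
  nonempty interior, so no piece can belong to both sides.\<close>

lemma is_tiling_juxtapose:
  assumes Q1: "is_tiling (Rect n m') T' Q1" and Q2: "is_tiling (Rect n m'') T'' Q2"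
    and T': "set_mset T' \<subseteq> rect_polyominoes"
  shows "is_tiling (Rect n (m' + m'')) (T' + T'') (Q1 \<union> shift (real m', 0) ` Q2)"
proof -
  define s where "s = shift (real m', 0)"
  have inj: "inj s"
    unfolding s_def by (rule inj_on_inverseI[where g = "shift (- real m', 0)"])
      (simp add: shift_shift flip: zero_prod_def)
  have cross: "interior (A \<inter> s B) = {}" if "A \<in> Q1" "B \<in> Q2" for A B
  proof -
    have "A \<subseteq> {0..real m'} \<times> {0..real n}"
      using is_tiling_subset[OF Q1 that(1)] Rect_subset by blast
    moreover have "s B \<subseteq> {real m'..real m' + real m''} \<times> {0..real n}"
      using is_tiling_subset[OF Q2 that(2)] Rect_subset[of n m'']
      by (fastforce simp: s_def shift_def)
    ultimately have "A \<inter> s B \<subseteq> {real m'} \<times> UNIV" by fastforce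
    then show ?thesis
      using interior_mono interior_vertical_line by blast
  qed
  have int_ne: "interior A \<noteq> {}" if A: "A \<in> Q1" for A
  proof -
    obtain a b where "shape_of A = rect_polyomino a b" "1 \<le> a" "1 \<le> b"
      using is_tiling_shape_of[OF Q1 A] T' by (auto simp: rect_polyominoes_def)
    then show ?thesis
      by (elim shape_of_eq_rect_polyominoD) (auto simp: interior_Times)
  qed
  \<comment> \<open>A common piece would be its own intersection with itself, contradicting
    \<open>cross\<close> and \<open>int_ne\<close>. Disjointness makes the multisets of shapes add
    up.\<close>
  have disj: "Q1 \<inter> s ` Q2 = {}"
    using cross int_ne by fastforce
  have fin: "finite Q1" "finite Q2"
    using Q1 Q2 by (auto simp: is_tiling_def)
  have "image_mset shape_of (mset_set (s ` Q2)) = image_mset shape_of (mset_set Q2)"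
    using inj by (simp add: image_mset_mset_set[symmetric] inj_on_subset image_mset.compositionality
        comp_def s_def)
  then have ms: "image_mset shape_of (mset_set (Q1 \<union> s ` Q2)) = T' + T''"
    using Q1 Q2 fin disj by (simp add: mset_set_Union is_tiling_def)
  have un: "\<Union>(Q1 \<union> s ` Q2) = Rect n (m' + m'')"
  proof -
    have "\<Union>(s ` Q2) = s (\<Union>Q2)" by (auto simp: s_def shift_def)
    then show ?thesis
      using Q1 Q2 by (simp add: Rect_add is_tiling_def s_def)
  qed
  have "interior (A \<inter> B) = {}" if AB: "A \<in> Q1 \<union> s ` Q2" "B \<in> Q1 \<union> s ` Q2" "A \<noteq> B" for A B
  proof -
    have "interior (s C \<inter> s D) = {}" if "C \<in> Q2" "D \<in> Q2" "s C \<noteq> s D" for C D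
    proof -
      have "s C \<inter> s D = s (C \<inter> D)"
        unfolding s_def shift_def by (simp add: image_Int)
      moreover have "interior (C \<inter> D) = {}"
        by (rule is_tiling_interior[OF Q2]) (use that in auto)
      ultimately have "interior (s C \<inter> s D) = shift (real m', 0) {}"
        by (simp only: s_def interior_shift)
      then show ?thesis
        by (simp only: shift_def image_empty)
    qed
    moreover have "interior (C \<inter> D) = {}" if "C \<in> Q1" "D \<in> Q1" "C \<noteq> D" for C D
      using is_tiling_interior[OF Q1] that .
    moreover have "interior (s C \<inter> D) = {}" if "C \<in> Q2" "D \<in> Q1" for C D
      using cross[OF that(2,1)] by (simp only: Int_commute)
    ultimately show ?thesis
      using AB cross by (elim UnE imageE) (simp_all only:)
  qed
  then show ?thesis
    using fin ms un unfolding is_tiling_def s_def by blast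
qed

section \<open>Dickson's lemma\<close>

text \<open>A decreasing sequence of naturals is constant from any index where it attains its
  minimum, so a decreasing subsequence has a tail that also counts as increasing.\<close>

lemma nat_seq_mono_subseq:
  fixes g :: "nat \<Rightarrow> nat"
  obtains s :: "nat \<Rightarrow> nat" where "strict_mono s" "mono (\<lambda>i. g (s i))"
proof -
  obtain s where s: "strict_mono s" "monoseq (\<lambda>i. g (s i))"
    using seq_monosub[of g] by blast
  from s(2) consider "incseq (\<lambda>i. g (s i))" | "decseq (\<lambda>i. g (s i))"
    by (auto simp: monoseq_iff)
  then show thesis
  proof cases
    case 1
    show ?thesis using that[OF s(1) 1] .
  next
    case 2
    obtain N where N: "\<And>i. g (s N) \<le> g (s i)"
      using ex_has_least_nat[of "\<lambda>_. True" _ "\<lambda>i. g (s i)"] by blast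
    have "g (s (i + N)) = g (s N)" for i
      using decseqD[OF 2, of N "i + N"] N[of "i + N"] by simp
    then have "mono (\<lambda>i. g (s (i + N)))" by (simp add: mono_def)
    moreover have "strict_mono (\<lambda>i. s (i + N))"
      using s(1) by (simp add: strict_mono_def)
    ultimately show ?thesis using that by simp
  qed
qed

text \<open>The subsequence is refined once for each coordinate in \<open>K\<close>; passing to a
  further subsequence keeps the earlier coordinates monotone.\<close>

lemma Dickson_mono_subseq:
  fixes f :: "nat \<Rightarrow> 'a \<Rightarrow> nat"
  assumes "finite K"
  shows "\<exists>r :: nat \<Rightarrow> nat. strict_mono r \<and> (\<forall>k\<in>K. mono (\<lambda>i. f (r i) k))"
  using assms
proof induction
  case empty
  show ?case using strict_mono_id by blast
next
  case (insert x K)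
  then obtain r :: "nat \<Rightarrow> nat"
    where r: "strict_mono r" "\<forall>k\<in>K. mono (\<lambda>i. f (r i) k)" by blast
  obtain s :: "nat \<Rightarrow> nat" where s: "strict_mono s" "mono (\<lambda>i. f (r (s i)) x)"
    using nat_seq_mono_subseq[of "\<lambda>i. f (r i) x"] .
  have "strict_mono (\<lambda>i. r (s i))"
    using strict_mono_o[OF r(1) s(1)] by (simp add: comp_def)
  moreover have "mono (\<lambda>i. f (r (s i)) k)" if "k \<in> K" for k
    using r(2) that strict_mono_mono[OF s(1)] unfolding mono_def by blast
  ultimately show ?case using s(2) by blast
qed

section \<open>Lengths of covering intervals\<close>

text \<open>Intervals whose intersection has empty interior overlap in a null set, so Lebesgue
  measure is additive on the cover.\<close>

lemma sum_length_of_interval_cover: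
  fixes x b :: "'a \<Rightarrow> real"
  assumes "finite S" "\<And>A. A \<in> S \<Longrightarrow> 0 \<le> b A" "0 \<le> m"
    and cover: "(\<Union>A\<in>S. {x A..x A + b A}) = {0..m}"
    and disj: "\<And>A B. A \<in> S \<Longrightarrow> B \<in> S \<Longrightarrow> A \<noteq> B \<Longrightarrow>
      interior ({x A..x A + b A} \<inter> {x B..x B + b B}) = {}"
  shows "(\<Sum>A\<in>S. b A) = m"
proof -
  have neg: "negligible ({p..q} \<inter> {r..s})" if "interior ({p..q} \<inter> {r..s}) = {}"
    for p q r s :: real
  proof -
    \<comment> \<open>The intersection is a closed interval, and it is negligible exactly when the
      corresponding open interval is empty.\<close>
    have "box (max p r) (min q s) = {}"
      using that by (simp add: Int_atLeastAtMost)
    then have "negligible (cbox (max p r) (min q s))"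
      by (simp only: negligible_interval)
    then show ?thesis by (simp add: Int_atLeastAtMost)
  qed
  have "m = measure lebesgue (\<Union>((\<lambda>A. {x A..x A + b A}) ` S))"
    using cover assms(3) by simp
  also have "\<dots> = (\<Sum>A\<in>S. measure lebesgue {x A..x A + b A})"
    by (rule measure_negligible_finite_Union_image)
      (use assms neg in \<open>auto simp: pairwise_def\<close>)
  also have "\<dots> = (\<Sum>A\<in>S. b A)"
    by (rule sum.cong) (use assms in auto)
  finally show ?thesis by simp
qed

section \<open>Tilings as balanced multisets of placements\<close>

definition placements :: "nat \<Rightarrow> shape set \<Rightarrow> ((nat \<times> nat) \<times> nat set) set" where
  "placements n L = {((a, b), \<iota>). 1 \<le> a \<and> 1 \<le> b \<and> rect_polyomino a b \<in> L \<and>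
                                   \<iota> \<in> intervals n \<and> card \<iota> = a}"

definition balanced :: "nat \<Rightarrow> nat \<Rightarrow> ((nat \<times> nat) \<times> nat set) multiset \<Rightarrow> bool" where
  "balanced n m P \<longleftrightarrow>
     (\<Sum>((a, b), \<iota>) \<in># P. a * b) = n * m \<and>
     (\<forall>i\<in>{1..n}. (\<Sum>((a, b), \<iota>) \<in># {#((a, b), \<iota>) \<in># P. i \<in> \<iota>#}. b) = m)"

text \<open>All sums are additive in the multiset and all right-hand sides in the width, so the
  equations for \<open>P\<close> cancel.\<close>

lemma balanced_diff:
  assumes "balanced n m P" "balanced n (m + m') (P + P')"
  shows "balanced n m' P'"
  using assms by (simp add: balanced_def distrib_left)

lemma finite_placements:
  assumes "finite L"
  shows "finite (placements n L)"
proof -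
  define S where "S = {(a, b). 1 \<le> a \<and> 1 \<le> b \<and> rect_polyomino a b \<in> L}"
  have "inj_on (\<lambda>(a, b). rect_polyomino a b) S"
    by (auto simp: inj_on_def S_def dest: rect_polyomino_inject)
  moreover have "finite ((\<lambda>(a, b). rect_polyomino a b) ` S)"
    by (rule finite_subset[OF _ assms]) (auto simp: S_def)
  ultimately have "finite S" by (rule finite_imageD[rotated])
  moreover have "intervals n \<subseteq> Pow {1..n}" by (auto simp: intervals_def)
  then have "finite (intervals n)" by (rule finite_subset) simp
  moreover have "placements n L \<subseteq> S \<times> intervals n"
    by (auto simp: placements_def S_def)
  ultimately show ?thesis by (meson finite_SigmaI finite_subset)
qed

text \<open>The assigned rows are forgotten in the conclusion, since a rearrangement only has to
  preserve the multiset of shapes.\<close>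

lemma representable_tiling:
  assumes "representable n L" "set_mset P \<subseteq> placements n L" "balanced n m P"
  obtains Q where "is_tiling (Rect n m) {#rect_polyomino a b. ((a, b), \<iota>) \<in># P#} Q"
proof -
  have "\<forall>((a, b), \<iota>) \<in># P. 1 \<le> a \<and> 1 \<le> b \<and> rect_polyomino a b \<in> L \<and>
          \<iota> \<in> intervals n \<and> card \<iota> = a"
    using assms(2) by (auto simp: placements_def)
  with assms(1,3) that show thesis
    unfolding representable_def balanced_def by blast
qed

text \<open>
  Pieces of a tiling are not required to sit at integer positions, so a piece is assigned the rows
  obtained by rounding its bottom edge down. A horizontal line in row \<open>i\<close> above the fractional
  parts of all bottom edges meets exactly the pieces assigned to that row.
\<close>

lemma balanced_multiset_of_tiling:
  assumes "tiling_by_elements (Rect n m) L Q" "L \<subseteq> rect_polyominoes" "1 \<le> m"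
  obtains P where "set_mset P \<subseteq> placements n L" "balanced n m P"
    "is_tiling (Rect n m) {#rect_polyomino a b. ((a, b), \<iota>) \<in># P#} Q"
proof -
  obtain T where T: "set_mset T \<subseteq> L" and Q: "is_tiling (Rect n m) T Q"
    using assms(1) by (auto simp: tiling_by_elements_def)
  have fin: "finite Q" using Q by (simp add: is_tiling_def)
  have "\<exists>a b x y. shape_of A = rect_polyomino a b \<and> 1 \<le> a \<and> 1 \<le> b \<and>
          A = {x..x + real b} \<times> {y..y + real a}" if A: "A \<in> Q" for A
  proof -
    have "shape_of A \<in> rect_polyominoes"
      using is_tiling_shape_of[OF Q A] T assms(2) by blast
    then obtain a b where ab: "shape_of A = rect_polyomino a b" "1 \<le> a" "1 \<le> b"
      by (auto simp: rect_polyominoes_def)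
    with shape_of_eq_rect_polyominoD[OF ab] show ?thesis by metis
  qed
  then obtain a b x y where
    shape: "\<And>A. A \<in> Q \<Longrightarrow> shape_of A = rect_polyomino (a A) (b A)"
    and pos: "\<And>A. A \<in> Q \<Longrightarrow> 1 \<le> a A" "\<And>A. A \<in> Q \<Longrightarrow> 1 \<le> b A"
    and A_eq: "\<And>A. A \<in> Q \<Longrightarrow> A = {x A..x A + real (b A)} \<times> {y A..y A + real (a A)}"
    by metis
  \<comment> \<open>Row \<open>i\<close> is the strip from \<open>i - 1\<close> to \<open>i\<close>,
    so a bottom edge with floor \<open>k\<close> starts in row \<open>k + 1\<close>.\<close>
  define \<iota> where "\<iota> A = {nat \<lfloor>y A\<rfloor> + 1..nat \<lfloor>y A\<rfloor> + a A}" for A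
  define P where "P = image_mset (\<lambda>A. ((a A, b A), \<iota> A)) (mset_set Q)"
  have y: "0 \<le> y A" "y A + real (a A) \<le> real n" if A: "A \<in> Q" for A
  proof -
    have "(x A, y A) \<in> A" "(x A, y A + real (a A)) \<in> A"
      using A_eq[OF A] by auto
    then show "0 \<le> y A" "y A + real (a A) \<le> real n"
      using is_tiling_subset[OF Q A] Rect_subset[of n m] by auto
  qed
  have \<iota>_sub: "nat \<lfloor>y A\<rfloor> + a A \<le> n" if A: "A \<in> Q" for A
    using y[OF A] by linarith
  have "\<iota> A \<in> intervals n" "card (\<iota> A) = a A" if A: "A \<in> Q" for A
    unfolding \<iota>_def intervals_def using \<iota>_sub[OF A] pos(1)[OF A] by fastforce+
  moreover have "shape_of A \<in> L" if "A \<in> Q" for A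
    using is_tiling_shape_of[OF Q that] T by blast
  ultimately have sub: "set_mset P \<subseteq> placements n L"
    using fin pos shape by (auto simp: P_def placements_def)
  \<comment> \<open>Inserting 0 covers an empty \<open>Q\<close> and forces \<open>t\<close> to be
    positive.\<close>
  have "Max (insert 0 ((\<lambda>A. frac (y A)) ` Q)) < 1"
    using fin by (simp add: frac_lt_1)
  then obtain t where "Max (insert 0 ((\<lambda>A. frac (y A)) ` Q)) < t" "t < 1"
    using dense by blast
  then have t: "0 < t" "t < 1" "\<And>A. A \<in> Q \<Longrightarrow> frac (y A) < t"
    using fin by auto
  have row: "(\<Sum>A | A \<in> Q \<and> i \<in> \<iota> A. b A) = m" if i: "i \<in> {1..n}" for i
  proof -
    define h where "h = real i - 1 + t"
    define S where "S = {A \<in> Q. i \<in> \<iota> A}"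
    \<comment> \<open>Strictness matters: the line at height \<open>h\<close> must run through the
      interior of each assigned piece. It follows from \<open>frac (y A) < t < 1\<close>.\<close>
    have open_h: "h \<in> {y A<..<y A + real (a A)}" if "A \<in> S" for A
    proof -
      have "A \<in> Q" "nat \<lfloor>y A\<rfloor> + 1 \<le> i" "i \<le> nat \<lfloor>y A\<rfloor> + a A"
        using that by (auto simp: S_def \<iota>_def)
      then have "real (nat \<lfloor>y A\<rfloor>) + 1 \<le> real i" "real i \<le> real (nat \<lfloor>y A\<rfloor>) + real (a A)"
        by linarith+
      moreover have "real (nat \<lfloor>y A\<rfloor>) = y A - frac (y A)"
        using y(1)[OF \<open>A \<in> Q\<close>] by (simp add: frac_def)
      ultimately show ?thesis
        using t(2) t(3)[OF \<open>A \<in> Q\<close>] frac_ge_0[of "y A"]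
        unfolding h_def greaterThanLessThan_iff by (intro conjI; linarith)
    qed
    have closed_h: "A \<in> S" if A: "A \<in> Q" and "h \<in> {y A..y A + real (a A)}" for A
    proof -
      have fl: "real (nat \<lfloor>y A\<rfloor>) = y A - frac (y A)"
        using y(1)[OF A] by (simp add: frac_def)
      have "real (nat \<lfloor>y A\<rfloor>) < real i" "real i < real (nat \<lfloor>y A\<rfloor>) + real (a A) + 1"
        using fl that t(2) t(3)[OF A] frac_ge_0[of "y A"] unfolding h_def atLeastAtMost_iff by linarith+
      then show ?thesis
        using A by (auto simp: S_def \<iota>_def)
    qed
    have h: "h \<in> {0..real n}" using i t by (auto simp: h_def)
    have "(\<Sum>A\<in>S. real (b A)) = real m"
    proof (rule sum_length_of_interval_cover)
      \<comment> \<open>By \<open>open_h\<close> and \<open>closed_h\<close>, the pieces in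
        \<open>S\<close> are exactly those meeting the line, so their horizontal extents cover the
        slice of the rectangle at height \<open>h\<close>.\<close>
      have "(\<Union>A\<in>S. {x A..x A + real (b A)}) = {z. \<exists>A\<in>Q. (z, h) \<in> A}"
      proof (intro equalityI subsetI)
        fix z assume "z \<in> (\<Union>A\<in>S. {x A..x A + real (b A)})"
        then obtain A where A: "A \<in> S" "z \<in> {x A..x A + real (b A)}" by blast
        then have "A \<in> Q" by (simp add: S_def)
        moreover have "(z, h) \<in> {x A..x A + real (b A)} \<times> {y A..y A + real (a A)}"
          using A(2) open_h[OF A(1)] by auto
        ultimately show "z \<in> {z. \<exists>A\<in>Q. (z, h) \<in> A}" using A_eq by blast
      next
        fix z assume "z \<in> {z. \<exists>A\<in>Q. (z, h) \<in> A}"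
        then obtain A where A: "A \<in> Q" "(z, h) \<in> A" by blast
        then have "(z, h) \<in> {x A..x A + real (b A)} \<times> {y A..y A + real (a A)}"
          using A_eq by blast
        then show "z \<in> (\<Union>A\<in>S. {x A..x A + real (b A)})"
          using closed_h[OF A(1)] by blast
      qed
      also have "\<dots> = {z. (z, h) \<in> Rect n m}"
        using Q by (auto simp: is_tiling_def)
      also have "\<dots> = {0..real m}"
        using h i assms(3) by (simp add: Rect_eq_Times) auto
      finally show "(\<Union>A\<in>S. {x A..x A + real (b A)}) = {0..real m}" .
    next
      \<comment> \<open>The vertical extents of both pieces have \<open>h\<close> in their interior.
        As the interior of \<open>A \<inter> B\<close> is a product and is empty, its horizontal
        factor must be empty.\<close>
      fix A B assume AB: "A \<in> S" "B \<in> S" "A \<noteq> B"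
      then have inQ: "A \<in> Q" "B \<in> Q" by (auto simp: S_def)
      define X where "X = {x A..x A + real (b A)} \<inter> {x B..x B + real (b B)}"
      define Y where "Y = {y A..y A + real (a A)} \<inter> {y B..y B + real (a B)}"
      have "A \<inter> B = X \<times> Y"
        using arg_cong2[OF A_eq[OF inQ(1)] A_eq[OF inQ(2)], of "(\<inter>)"]
        by (simp only: Times_Int_Times X_def Y_def)
      moreover have "interior (A \<inter> B) = {}"
        using is_tiling_interior[OF Q inQ AB(3)] .
      ultimately have "interior X \<times> interior Y = {}"
        by (simp add: interior_Times)
      moreover have "h \<in> interior Y"
        unfolding Y_def using open_h[OF AB(1)] open_h[OF AB(2)] by simp
      ultimately show "interior ({x A..x A + real (b A)} \<inter> {x B..x B + real (b B)}) = {}"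
        unfolding X_def by blast
    qed (use fin in \<open>auto simp: S_def\<close>)
    then have "real (\<Sum>A\<in>S. b A) = real m" by simp
    then show ?thesis unfolding S_def by (simp only: of_nat_eq_iff)
  qed
  \<comment> \<open>Double counting: a piece contributes its width once for each of its rows, so the
    area condition follows from the row condition.\<close>
  have "(\<Sum>A\<in>Q. a A * b A) = (\<Sum>A\<in>Q. \<Sum>i | i \<in> {1..n} \<and> i \<in> \<iota> A. b A)"
  proof (rule sum.cong)
    fix A assume A: "A \<in> Q"
    have "{i. i \<in> {1..n} \<and> i \<in> \<iota> A} = \<iota> A"
      using \<iota>_sub[OF A] by (auto simp: \<iota>_def)
    then show "a A * b A = (\<Sum>i | i \<in> {1..n} \<and> i \<in> \<iota> A. b A)"
      by (simp add: \<iota>_def)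
  qed simp
  also have "\<dots> = (\<Sum>i\<in>{1..n}. \<Sum>A | A \<in> Q \<and> i \<in> \<iota> A. b A)"
    by (rule sum.swap_restrict) (use fin in auto)
  also have "\<dots> = n * m"
    using row by simp
  finally have area: "(\<Sum>A\<in>Q. a A * b A) = n * m" .
  have bal: "balanced n m P"
    using area row fin
    by (simp add: balanced_def P_def image_mset.compositionality comp_def
        filter_mset_image_mset sum_unfold_sum_mset[symmetric])
  have "T = {#rect_polyomino a b. ((a, b), \<iota>) \<in># P#}"
  proof -
    have "T = image_mset shape_of (mset_set Q)" using Q by (simp add: is_tiling_def)
    also have "\<dots> = image_mset (\<lambda>A. rect_polyomino (a A) (b A)) (mset_set Q)"
      by (rule image_mset_cong) (use fin shape in auto)
    finally show ?thesis
      by (simp add: P_def image_mset.compositionality comp_def)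
  qed
  with Q sub bal that show thesis by blast
qed

theorem theorem3p6:
  fixes n :: nat and L :: "shape set"
  assumes "finite L" and "L \<subseteq> rect_polyominoes" and "representable n L"
  shows "strongly_Noetherian n L"
proof (rule ccontr)
  let ?T = "\<lambda>P :: ((nat \<times> nat) \<times> nat set) multiset. {#rect_polyomino a b. ((a, b), \<iota>) \<in># P#}"
  assume "\<not> strongly_Noetherian n L"
  then have "\<forall>N. \<not> subtiling_bound n L N"
    by (auto simp: strongly_Noetherian_def beta_def split: if_splits)
  then have "\<forall>N. \<exists>m Q. N < m \<and> tiling_by_elements (Rect n m) L Q \<and> \<not> admits_subtiling n m Q"
    unfolding subtiling_bound_def by blast
  then obtain m Q where mQ: "\<And>N. N < m N" "\<And>N. tiling_by_elements (Rect n (m N)) L (Q N)"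
    and bad: "\<And>N. \<not> admits_subtiling n (m N) (Q N)"
    by metis
  have "\<exists>P. set_mset P \<subseteq> placements n L \<and> balanced n (m N) P \<and>
          is_tiling (Rect n (m N)) (?T P) (Q N)" for N
  proof -
    have "1 \<le> m N" using mQ(1)[of N] by linarith
    then show ?thesis
      using balanced_multiset_of_tiling[OF mQ(2) assms(2)] by metis
  qed
  then obtain P where P: "\<And>N. set_mset (P N) \<subseteq> placements n L" "\<And>N. balanced n (m N) (P N)"
    "\<And>N. is_tiling (Rect n (m N)) (?T (P N)) (Q N)"
    by metis
  obtain r :: "nat \<Rightarrow> nat"
    where r: "strict_mono r" "\<forall>k\<in>placements n L. mono (\<lambda>i. count (P (r i)) k)"
    using Dickson_mono_subseq[OF finite_placements[OF assms(1)], where f = "\<lambda>i. count (P i)"] by blast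
  define i where "i = r 0"
  \<comment> \<open>Since \<open>r\<close> is strictly increasing and every width exceeds its index,
    \<open>m j > j \<ge> m i\<close>. Thus the second tiling is strictly wider as well as later in
    the subsequence.\<close>
  define j where "j = r (m i)"
  have "m i < m j"
    using strict_mono_imp_increasing[OF r(1), of "m i"] mQ(1)[of j] by (simp add: j_def)
  then obtain m'' where m'': "m j = m i + m''" "m'' \<noteq> 0"
    by (metis less_imp_add_positive less_numeral_extra(3))
  have "P i \<subseteq># P j"
  proof (rule mset_subset_eqI)
    fix k
    show "count (P i) k \<le> count (P j) k"
    proof (cases "k \<in> placements n L")
      case True
      then show ?thesis
        using r(2) by (auto simp: i_def j_def mono_def)
    next
      \<comment> \<open>Monotonicity is known only on \<open>placements n L\<close>; elsewhere the
        count in \<open>P i\<close> is zero.\<close>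
      case False
      then show ?thesis
        using P(1)[of i] by (metis count_eq_zero_iff le0 subsetD)
    qed
  qed
  then obtain P'' where P'': "P j = P i + P''"
    by (auto simp: mset_subset_eq_exists_conv)
  have "balanced n m'' P''"
    using balanced_diff P(2)[of i] P(2)[of j] m''(1) P'' by metis
  moreover have "set_mset P'' \<subseteq> placements n L"
    using P(1)[of j] P'' by simp
  ultimately obtain Q2 where Q2: "is_tiling (Rect n m'') (?T P'') Q2"
    using representable_tiling[OF assms(3)] by blast
  have "set_mset (?T (P i)) \<subseteq> rect_polyominoes"
    using P(1)[of i] assms(2) by (fastforce simp: placements_def)
  then have "is_tiling (Rect n (m j)) (?T (P j)) (Q i \<union> shift (real (m i), 0) ` Q2)"
    using is_tiling_juxtapose[OF P(3)[of i] Q2] m''(1) P'' by simp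
  \<comment> \<open>The juxtaposition and \<open>Q j\<close> tile the same rectangle with the same
    multiset of shapes; the left width is nonzero because \<open>m i > i\<close>.\<close>
  then have "admits_subtiling n (m j) (Q j)"
    using P(3)[of i] P(3)[of j] Q2 m'' mQ(1)[of i] not_less_zero
    unfolding admits_subtiling_def rearrangement_def by metis
  then show False using bad by blast
qed

end
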